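(* Suppose that $\mathfrak{B}:[0,\infty)\to[0,\infty)$ is non-decreasing and differentiable, $a\in(1,\infty)$, and $h,H:[\mathfrak{B}^{-1}(1),\infty)\to[0,\infty)$ are non-increasing with $\lim_{t\to\infty}h(t)=0$ and $\lim_{t\to\infty}H(t)=0$, such that for all $t\in[\mathfrak{B}^{-1}(1),\infty)$ and a constant $C>0$, $$-\int_t^\infty\mathfrak{B}(s)\,\mathrm{d}h(s)\le a\,\mathfrak{B}(t)h(t)+C\,H(t).$$ Then, for every $\epsilon\in[0,\frac{1}{a-1})$, $$-\int_{\mathfrak{B}^{-1}(1)}^\infty\mathfrak{B}^{1+\epsilon}(t)\,\mathrm{d}h(t)\le\frac{1}{1-\epsilon(a-1)}\Big(-\int_{\mathfrak{B}^{-1}(1)}^\infty\mathfrak{B}(t)\,\mathrm{d}h(t)\Big)+\frac{C\epsilon}{1-\epsilon(a-1)}\Big(-\int_{\mathfrak{B}^{-1}(1)}^\infty\mathfrak{B}^{1+\epsilon}(t)\,\mathrm{d}H(t)\Big).$$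
   Context: The integrals with respect to $\mathrm{d}h$ and $\mathrm{d}H$ are (improper) Stieltjes integrals, with values in $[0,\infty]$ after the sign change. $\mathfrak{B}^{-1}(1)$ denotes a point of $[0,\infty)$ at which $\mathfrak{B}$ takes the value $1$ (assumed to exist). $\mathfrak{B}^{1+\epsilon}(t)=(\mathfrak{B}(t))^{1+\epsilon}$. *)

theory Defs
  imports "HOL-Analysis.Analysis"
begin

text \<open>
  Riemann--Stieltjes integral of \<open>f\<close> with respect to \<open>g\<close> over \<open>[u, v]\<close>, \<open>u \<le> v\<close>: the limit of the
  sums \<open>\<Sum>\<^sub>i f(\<xi>\<^sub>i) (g(x\<^sub>i\<^sub>+\<^sub>1) - g(x\<^sub>i))\<close> over tagged partitions as the mesh tends to 0.
  A cell \<open>K = [x\<^sub>i, x\<^sub>i\<^sub>+\<^sub>1]\<close> with tag \<open>\<xi>\<close> is fine for the constant gauge if \<open>K \<subseteq> ball \<xi> d\<close>. As \<open>d\<close> does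
  not depend on the tag, this is smallness of the mesh and not a Henstock condition.
\<close>

definition has_RS_integral ::
    "(real \<Rightarrow> real) \<Rightarrow> (real \<Rightarrow> real) \<Rightarrow> real \<Rightarrow> real \<Rightarrow> real \<Rightarrow> bool" where
  "has_RS_integral f g u v I \<longleftrightarrow>
     (\<forall>e>0. \<exists>d>0. \<forall>p. p tagged_division_of {u..v} \<and> (\<lambda>\<xi>. ball \<xi> d) fine p \<longrightarrow>
        \<bar>(\<Sum>(\<xi>, K)\<in>p. f \<xi> * (g (Sup K) - g (Inf K))) - I\<bar> < e)"

definition RS_integral :: "(real \<Rightarrow> real) \<Rightarrow> (real \<Rightarrow> real) \<Rightarrow> real \<Rightarrow> real \<Rightarrow> real" where
  "RS_integral f g u v = (THE I. has_RS_integral f g u v I)"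

text \<open>
  The improper integral over \<open>[u, \<infinity>)\<close>. For \<open>f \<ge> 0\<close> continuous and \<open>g\<close> non-increasing on \<open>[u, \<infinity>)\<close> the
  proper integrals exist and are non-increasing in the upper endpoint, so the limit exists in
  \<open>[-\<infinity>, 0]\<close>. A jump of \<open>g\<close> at \<open>u\<close> contributes through the right jump \<open>g(u+) - g(u)\<close> only.
\<close>

definition RS_integral_to_infinity :: "(real \<Rightarrow> real) \<Rightarrow> (real \<Rightarrow> real) \<Rightarrow> real \<Rightarrow> ereal" where
  "RS_integral_to_infinity f g u = Lim at_top (\<lambda>T. ereal (RS_integral f g u T))"

end

theory Submission
  imports Defs
begin

text \<open>
  Write \<open>q = 1 + \<epsilon>\<close>, \<open>k = a \<epsilon> / q < 1\<close> and let \<open>R(t)\<close> be the tail integral \<open>-\<integral>\<^sub>t\<^sup>\<infinity> B dh\<close> with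
  \<open>h\<close> cut off to 0 after \<open>T\<close>. Formally \<open>B\<^sup>q (-dh) = -B\<^sup>\<epsilon> dR = -d(B\<^sup>\<epsilon> R) + R d(B\<^sup>\<epsilon>)\<close>, and the hypothesis
  \<open>R \<le> a B h + C H\<close> together with \<open>B d(B\<^sup>\<epsilon>) = (\<epsilon> / q) d(B\<^sup>q)\<close> and \<open>B \<ge> 1\<close> gives
  \<open>R d(B\<^sup>\<epsilon>) \<le> (k h + (C \<epsilon> / q) H) d(B\<^sup>q)\<close>; a second integration by parts turns the right-hand side back
  into integrals against \<open>dh\<close> and \<open>dH\<close>. The term in \<open>dh\<close> is absorbed because \<open>k < 1\<close>. The cut-off
  makes all terms finite and cancels the boundary terms at \<open>T\<close>.

  The formal identities are read as inequalities between increments over short intervals, up to an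
  error that vanishes on summation.
\<close>

section \<open>Uniqueness and existence of the Riemann-Stieltjes integral\<close>

lemma has_RS_integral_unique:
  assumes "has_RS_integral f g u v I" "has_RS_integral f g u v J"
  shows "I = J"
proof (rule ccontr)
  assume "I \<noteq> J"
  define e where "e = \<bar>I - J\<bar> / 2"
  have e: "e > 0" using \<open>I \<noteq> J\<close> by (simp add: e_def)
  let ?S = "\<lambda>p. \<Sum>(\<xi>, K)\<in>p. f \<xi> * (g (Sup K) - g (Inf K))"
  obtain d1 where d1: "d1 > 0"
    "\<And>p. p tagged_division_of {u..v} \<Longrightarrow> (\<lambda>\<xi>. ball \<xi> d1) fine p \<Longrightarrow> \<bar>?S p - I\<bar> < e"
    using assms(1) e unfolding has_RS_integral_def by meson
  obtain d2 where d2: "d2 > 0"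
    "\<And>p. p tagged_division_of {u..v} \<Longrightarrow> (\<lambda>\<xi>. ball \<xi> d2) fine p \<Longrightarrow> \<bar>?S p - J\<bar> < e"
    using assms(2) e unfolding has_RS_integral_def by meson
  have "gauge (\<lambda>\<xi>::real. ball \<xi> (min d1 d2))"
    using d1(1) d2(1) by (intro gauge_ball) simp
  then obtain p where p: "p tagged_division_of {u..v}" "(\<lambda>\<xi>. ball \<xi> (min d1 d2)) fine p"
    using fine_division_exists_real by blast
  have "(\<lambda>\<xi>. ball \<xi> d1) fine p" "(\<lambda>\<xi>. ball \<xi> d2) fine p"
    using p(2) unfolding fine_def by force+
  with d1(2) d2(2) p(1) have "\<bar>?S p - I\<bar> < e" "\<bar>?S p - J\<bar> < e" by blast+
  then show False unfolding e_def by argo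
qed

lemma RS_integral_eqI: "has_RS_integral f g u v I \<Longrightarrow> RS_integral f g u v = I"
  unfolding RS_integral_def by (blast intro: has_RS_integral_unique)

lemma tagged_division_of_real_cell:
  fixes u v :: real
  assumes "p tagged_division_of {u..v}" "(\<xi>, K) \<in> p"
  shows "u \<le> Inf K" "Inf K \<le> \<xi>" "\<xi> \<le> Sup K" "Sup K \<le> v" "Inf K \<in> K" "Sup K \<in> K"
proof -
  obtain c d where K: "K = cbox c d" using tagged_division_ofD(4)[OF assms] by blast
  have "\<xi> \<in> K" "K \<subseteq> {u..v}" using tagged_division_ofD(2,3)[OF assms] by auto
  then show "u \<le> Inf K" "Inf K \<le> \<xi>" "\<xi> \<le> Sup K" "Sup K \<le> v" "Inf K \<in> K" "Sup K \<in> K"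
    unfolding K by (auto simp: subset_iff)
qed

text \<open>\<open>\<Phi>\<close> acts as an indefinite integral of \<open>f\<close> against
  \<open>- g\<close>. On a cell, its increment and the sign-changed Stieltjes term lie between the
  same two bounds, so they differ by at most the oscillation of \<open>f\<close> times the drop of
  \<open>g\<close>. Uniform continuity makes the oscillation less than \<eta>, and the errors
  telescope to \<open>\<eta> * (g u - g v)\<close>.\<close>

lemma has_RS_integral_primitive:
  fixes f g \<Phi> :: "real \<Rightarrow> real"
  assumes uv: "u \<le> v"
    and f: "continuous_on {u..v} f" "mono_on {u..v} f"
    and g: "antimono_on {u..v} g"
    and \<Phi>: "\<And>x y. u \<le> x \<Longrightarrow> x \<le> y \<Longrightarrow> y \<le> v \<Longrightarrow>
      f x * (g x - g y) \<le> \<Phi> y - \<Phi> x \<and> \<Phi> y - \<Phi> x \<le> f y * (g x - g y)"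
  shows "has_RS_integral f g u v (\<Phi> u - \<Phi> v)"
  unfolding has_RS_integral_def
proof (intro allI impI)
  fix e :: real assume e: "e > 0"
  have guv: "g v \<le> g u" using g uv by (auto simp: monotone_on_def)
  \<comment> \<open>The \<open>+ 1\<close> keeps the denominator positive when \<open>g\<close> is
    constant and makes \<open>small\<close> strict.\<close>
  define \<eta> where "\<eta> = e / (g u - g v + 1)"
  have \<eta>: "\<eta> > 0" using e guv by (simp add: \<eta>_def)
  have small: "\<eta> * (g u - g v) < e"
    using e guv by (simp add: \<eta>_def field_simps)
  have "uniformly_continuous_on {u..v} f"
    using f(1) by (simp add: compact_uniformly_continuous)
  then obtain d where d: "d > 0"
    "\<And>x y. x \<in> {u..v} \<Longrightarrow> y \<in> {u..v} \<Longrightarrow> dist y x < d \<Longrightarrow> dist (f y) (f x) < \<eta>"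
    using \<eta> unfolding uniformly_continuous_on_def by meson
  show "\<exists>d>0. \<forall>p. p tagged_division_of {u..v} \<and> (\<lambda>\<xi>. ball \<xi> d) fine p \<longrightarrow>
      \<bar>(\<Sum>(\<xi>, K)\<in>p. f \<xi> * (g (Sup K) - g (Inf K))) - (\<Phi> u - \<Phi> v)\<bar> < e"
  \<comment> \<open>Both ends of a cell are within \<open>d / 2\<close> of its tag, hence within
    \<open>d\<close> of each other.\<close>
  proof (intro exI[of _ "d / 2"] conjI allI impI)
    show "d / 2 > 0" using d(1) by simp
    fix p assume p: "p tagged_division_of {u..v} \<and> (\<lambda>\<xi>. ball \<xi> (d / 2)) fine p"
    then have pt: "p tagged_division_of {u..v}" by blast
    have cell: "\<bar>f \<xi> * (g (Sup K) - g (Inf K)) + (\<Phi> (Sup K) - \<Phi> (Inf K))\<bar>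
        \<le> \<eta> * (g (Inf K) - g (Sup K))" if "(\<xi>, K) \<in> p" for \<xi> K
    proof -
      note c = tagged_division_of_real_cell[OF pt that]
      have "K \<subseteq> ball \<xi> (d / 2)" using p that unfolding fine_def by blast
      then have "dist \<xi> (Inf K) < d / 2" "dist \<xi> (Sup K) < d / 2"
        using c(5,6) by auto
      then have "dist (Sup K) (Inf K) < d" unfolding dist_real_def by linarith
      then have "f (Sup K) - f (Inf K) < \<eta>"
        using d(2)[of "Inf K" "Sup K"] c(1-4) by (simp add: dist_real_def)
      moreover have "f (Inf K) \<le> f \<xi>" "f \<xi> \<le> f (Sup K)"
        using c(1-4) by (auto intro!: mono_onD[OF f(2)])
      moreover have g0: "0 \<le> g (Inf K) - g (Sup K)"
        using c(1-4) g by (auto simp: monotone_on_def)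
      ultimately have "f \<xi> - f (Inf K) \<le> \<eta>" "f (Sup K) - f \<xi> \<le> \<eta>" by linarith+
      then have "(f \<xi> - f (Inf K)) * (g (Inf K) - g (Sup K)) \<le> \<eta> * (g (Inf K) - g (Sup K))"
        "(f (Sup K) - f \<xi>) * (g (Inf K) - g (Sup K)) \<le> \<eta> * (g (Inf K) - g (Sup K))"
        using g0 by (auto intro: mult_right_mono)
      moreover have "f (Inf K) * (g (Inf K) - g (Sup K)) \<le> \<Phi> (Sup K) - \<Phi> (Inf K)"
        "\<Phi> (Sup K) - \<Phi> (Inf K) \<le> f (Sup K) * (g (Inf K) - g (Sup K))"
        using \<Phi>[of "Inf K" "Sup K"] c(1-4) by auto
      ultimately show ?thesis unfolding abs_le_iff by (simp add: algebra_simps)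
    qed
    have "(\<Sum>(\<xi>, K)\<in>p. f \<xi> * (g (Sup K) - g (Inf K))) - (\<Phi> u - \<Phi> v)
        = (\<Sum>(\<xi>, K)\<in>p. f \<xi> * (g (Sup K) - g (Inf K)) + (\<Phi> (Sup K) - \<Phi> (Inf K)))"
      using additive_tagged_division_1[OF uv pt, of \<Phi>]
      by (simp add: sum.distrib split_def)
    then have "\<bar>(\<Sum>(\<xi>, K)\<in>p. f \<xi> * (g (Sup K) - g (Inf K))) - (\<Phi> u - \<Phi> v)\<bar>
        \<le> (\<Sum>(\<xi>, K)\<in>p. \<eta> * (g (Inf K) - g (Sup K)))"
      using cell by (auto intro!: order.trans[OF sum_abs] sum_mono)
    also have "\<dots> = \<eta> * (g u - g v)"
      using additive_tagged_division_1[OF uv pt, of "\<lambda>x. - g x"]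
      by (simp add: split_def flip: sum_distrib_left)
    finally show "\<bar>(\<Sum>(\<xi>, K)\<in>p. f \<xi> * (g (Sup K) - g (Inf K))) - (\<Phi> u - \<Phi> v)\<bar> < e"
      using small by linarith
  qed
qed

text \<open>
  Integration by parts reduces \<open>\<integral> f dg\<close> to \<open>\<integral> g df\<close>, which for continuous monotone \<open>f\<close> is an ordinary
  integral of the monotone function \<open>g \<circ> \<phi>\<close>, where \<open>\<phi>\<close> is a right inverse of \<open>f\<close>.
\<close>

lemma RS_primitive_exists:
  fixes f g :: "real \<Rightarrow> real"
  assumes cont: "continuous_on {b..} f" and mono: "mono_on {b..} f" and anti: "antimono_on {b..} g"
  obtains \<Phi> where "\<And>u v. b \<le> u \<Longrightarrow> u \<le> v \<Longrightarrow>
    f u * (g u - g v) \<le> \<Phi> v - \<Phi> u \<and> \<Phi> v - \<Phi> u \<le> f v * (g u - g v)"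
proof -
  define \<phi> where "\<phi> y = (SOME t. b \<le> t \<and> f t = y)" for y
  have \<phi>: "b \<le> \<phi> y \<and> f (\<phi> y) = y" if "b \<le> v" "f b \<le> y" "y \<le> f v" for y v
  proof -
    have "continuous_on {b..v} f" using cont by (rule continuous_on_subset) auto
    then have "\<exists>t. b \<le> t \<and> f t = y" using IVT'[of f b y v] that by auto
    then show ?thesis unfolding \<phi>_def by (rule someI_ex)
  qed
  have f_less: "x < y" if "f x < f y" "b \<le> x" "b \<le> y" for x y
    using that mono_onD[OF mono, of y x] by force
  have \<phi>_mono: "mono_on {f b..f v} \<phi>" if "b \<le> v" for v
  proof (rule mono_onI)
    fix x y assume "x \<in> {f b..f v}" "y \<in> {f b..f v}" "x \<le> y"
    then show "\<phi> x \<le> \<phi> y"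
      using \<phi>[OF that, of x] \<phi>[OF that, of y] f_less[of "\<phi> x" "\<phi> y"] by (cases "x = y") auto
  qed
  define G where "G y = - g (\<phi> y)" for y
  have "mono_on {f b..f v} G" if "b \<le> v" for v
  proof (rule mono_onI)
    fix x y assume "x \<in> {f b..f v}" "y \<in> {f b..f v}" "x \<le> y"
    then show "G x \<le> G y"
      using \<phi>[OF that, of x] \<phi>[OF that, of y] mono_onD[OF \<phi>_mono[OF that], of x y] anti
      by (auto simp: G_def monotone_on_def)
  qed
  then have int: "G integrable_on {f b..f v}" if "b \<le> v" for v
    using that integrable_on_mono_on by blast
  \<comment> \<open>Integration by parts turns the sign-changed integral of \<open>f\<close> against
    \<open>g\<close> into \<open>- f * g\<close> plus the integral of \<open>g\<close> against
    \<open>f\<close>; substituting \<open>y = f t\<close> makes the latter the integral of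
    \<open>- G\<close>.\<close>
  define \<Phi> where "\<Phi> t = - integral {f b..f t} G - f t * g t" for t
  show thesis
  proof
    fix u v assume uv: "b \<le> u" "u \<le> v"
    have fuv: "f b \<le> f u" "f u \<le> f v" using uv by (auto intro!: mono_onD[OF mono])
    have intuv: "G integrable_on {f u..f v}"
      using int[of v] uv fuv by (auto intro: integrable_subinterval_real)
    then have intuv': "G integrable_on {f u<..<f v}" by (simp add: integrable_on_Icc_iff_Ioo)
    \<comment> \<open>The endpoints are left out because a plateau of \<open>f\<close> at level
      \<open>f u\<close> or \<open>f v\<close> may put \<open>\<phi> y\<close> outside
      \<open>[u, v]\<close>.\<close>
    have bnd: "- g u \<le> G y \<and> G y \<le> - g v" if "y \<in> {f u<..<f v}" for y
    proof -
      have "b \<le> \<phi> y" "f (\<phi> y) = y" using \<phi>[of v y] uv fuv that by auto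
      then have "u \<le> \<phi> y" "\<phi> y \<le> v"
        using f_less[of u "\<phi> y"] f_less[of "\<phi> y" v] that uv by auto
      then show ?thesis using anti uv by (auto simp: G_def monotone_on_def)
    qed
    have const: "((\<lambda>y. c) has_integral c * (f v - f u)) {f u<..<f v}" for c :: real
      using has_integral_const_real[of c "f u" "f v"] fuv
      by (simp add: mult.commute flip: has_integral_Icc_iff_Ioo)
    have "- g u * (f v - f u) \<le> integral {f u<..<f v} G"
      using has_integral_le[OF const[of "- g u"] integrable_integral[OF intuv']] bnd by blast
    moreover have "integral {f u<..<f v} G \<le> - g v * (f v - f u)"
      using has_integral_le[OF integrable_integral[OF intuv'] const[of "- g v"]] bnd by blast
    moreover have "integral {f b..f u} G + integral {f u<..<f v} G = integral {f b..f v} G"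
      using Henstock_Kurzweil_Integration.integral_combine[OF fuv int] uv
      by (simp flip: integral_open_interval_real)
    ultimately show "f u * (g u - g v) \<le> \<Phi> v - \<Phi> u \<and> \<Phi> v - \<Phi> u \<le> f v * (g u - g v)"
      unfolding \<Phi>_def by (simp add: algebra_simps)
  qed
qed

section \<open>Improper integrals as suprema\<close>

lemma Lim_at_top_antimono_eq_INF:
  fixes f :: "real \<Rightarrow> ereal"
  assumes "antimono_on {u..} f"
  shows "Lim at_top f = (INF T\<in>{u..}. f T)"
proof (rule tendsto_Lim)
  show "(f \<longlongrightarrow> (INF T\<in>{u..}. f T)) at_top"
  proof (rule decreasing_tendsto)
    show "\<forall>\<^sub>F T in at_top. (INF T\<in>{u..}. f T) \<le> f T"
      using eventually_ge_at_top[of u] by eventually_elim (auto intro: INF_lower)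
  next
    fix x assume "(INF T\<in>{u..}. f T) < x"
    then obtain T where "u \<le> T" "f T < x" by (auto simp: INF_less_iff)
    show "\<forall>\<^sub>F T in at_top. f T < x"
      using eventually_ge_at_top[of T]
    proof eventually_elim
      case (elim t)
      then have "f t \<le> f T" using assms \<open>u \<le> T\<close> by (simp add: monotone_on_def)
      then show ?case using \<open>f T < x\<close> by simp
    qed
  qed
qed simp

text \<open>Since \<open>f\<close> is nonnegative, the primitive is non-decreasing, so the
  sign-changed limit is a supremum. An upper bound for the improper integral then only has to be
  proved at each finite \<open>T\<close>, and one \<open>\<Phi>\<close> serves all lower
  endpoints.\<close>

lemma RS_integral_to_infinity_eq_SUP:
  fixes f g :: "real \<Rightarrow> real"
  assumes cont: "continuous_on {b..} f" and mono: "mono_on {b..} f" and nonneg: "f b \<ge> 0"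
    and anti: "antimono_on {b..} g"
  obtains \<Phi> where
    "\<And>u v. b \<le> u \<Longrightarrow> u \<le> v \<Longrightarrow>
      f u * (g u - g v) \<le> \<Phi> v - \<Phi> u \<and> \<Phi> v - \<Phi> u \<le> f v * (g u - g v)"
    "\<And>u. b \<le> u \<Longrightarrow> - RS_integral_to_infinity f g u = (SUP T\<in>{u..}. ereal (\<Phi> T - \<Phi> u))"
proof -
  obtain \<Phi> where \<Phi>: "\<And>u v. b \<le> u \<Longrightarrow> u \<le> v \<Longrightarrow>
      f u * (g u - g v) \<le> \<Phi> v - \<Phi> u \<and> \<Phi> v - \<Phi> u \<le> f v * (g u - g v)"
    using RS_primitive_exists[OF cont mono anti] by blast
  have \<Phi>_mono: "\<Phi> u \<le> \<Phi> v" if "b \<le> u" "u \<le> v" for u v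
  proof -
    have "0 \<le> f u" using nonneg mono_onD[OF mono, of b u] that by auto
    moreover have "0 \<le> g u - g v" using anti that by (auto simp: monotone_on_def)
    ultimately have "0 \<le> f u * (g u - g v)" by simp
    then show ?thesis using \<Phi>[OF that] by linarith
  qed
  have "- RS_integral_to_infinity f g u = (SUP T\<in>{u..}. ereal (\<Phi> T - \<Phi> u))" if "b \<le> u" for u
  proof -
    have RS: "RS_integral f g u T = \<Phi> u - \<Phi> T" if "T \<ge> u" for T
    proof (intro RS_integral_eqI has_RS_integral_primitive)
      show "continuous_on {u..T} f" "mono_on {u..T} f" "antimono_on {u..T} g"
        using cont mono anti \<open>b \<le> u\<close>
        by (auto intro: continuous_on_subset monotone_on_subset)
    qed (use that \<open>b \<le> u\<close> \<Phi> in auto)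
    have "RS_integral_to_infinity f g u = (INF T\<in>{u..}. ereal (RS_integral f g u T))"
      unfolding RS_integral_to_infinity_def using \<Phi>_mono \<open>b \<le> u\<close>
      by (intro Lim_at_top_antimono_eq_INF) (auto simp: monotone_on_def RS)
    also have "\<dots> = (INF T\<in>{u..}. - ereal (\<Phi> T - \<Phi> u))"
      by (intro INF_cong) (auto simp: RS)
    finally show ?thesis by (simp only: ereal_INF_uminus_eq ereal_uminus_uminus)
  qed
  with \<Phi> show thesis using that by blast
qed

text \<open>Letting \<open>v\<close> tend to infinity in the assumed bound shows that the tail
  beyond \<open>T\<close> is at least \<open>f T * g T\<close>. So replacing \<open>g\<close> by 0
  after \<open>T\<close>, which costs exactly this jump term, never exceeds the improper
  integral.\<close>

lemma ereal_le_SUP_tail: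
  fixes f g \<Phi> :: "real \<Rightarrow> real"
  assumes \<Phi>: "\<And>v. T \<le> v \<Longrightarrow> f T * (g T - g v) \<le> \<Phi> v - \<Phi> T"
    and "u \<le> T" and lim: "(g \<longlongrightarrow> 0) at_top"
  shows "ereal (\<Phi> T - \<Phi> u + f T * g T) \<le> (SUP T\<in>{u..}. ereal (\<Phi> T - \<Phi> u))"
proof (rule tendsto_upperbound)
  have "((\<lambda>v. \<Phi> T - \<Phi> u + f T * (g T - g v)) \<longlongrightarrow> \<Phi> T - \<Phi> u + f T * (g T - 0)) at_top"
    by (intro tendsto_intros lim)
  then show "((\<lambda>v. ereal (\<Phi> T - \<Phi> u + f T * (g T - g v))) \<longlongrightarrow> ereal (\<Phi> T - \<Phi> u + f T * g T)) at_top"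
    by simp
  show "\<forall>\<^sub>F v in at_top. ereal (\<Phi> T - \<Phi> u + f T * (g T - g v)) \<le> (SUP T\<in>{u..}. ereal (\<Phi> T - \<Phi> u))"
    using eventually_ge_at_top[of T]
  proof eventually_elim
    case (elim v)
    then show ?case
      using \<Phi>[OF elim] \<open>u \<le> T\<close> by (intro SUP_upper2[of v]) auto
  qed
qed simp

section \<open>Increment inequalities\<close>

text \<open>Replaces a sign condition on a derivative and allows jumps: summing over a fine division
  telescopes both sides to \<open>D T - D b \<le> \<eta> * (M T - M b)\<close>, and then \<eta>
  tends to 0.\<close>

lemma nonincreasing_endpoints_if_small_increments:
  fixes D M :: "real \<Rightarrow> real"
  assumes "b \<le> T"
    and small: "\<And>\<eta>. \<eta> > 0 \<Longrightarrow> \<exists>d>0. \<forall>u v. b \<le> u \<and> u \<le> v \<and> v \<le> T \<and> v - u < d \<longrightarrow>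
      D v - D u \<le> \<eta> * (M v - M u)"
  shows "D T \<le> D b"
proof -
  have le: "D T - D b \<le> \<eta> * (M T - M b)" if "\<eta> > 0" for \<eta>
  proof -
    obtain d where d: "d > 0" "\<And>u v. b \<le> u \<Longrightarrow> u \<le> v \<Longrightarrow> v \<le> T \<Longrightarrow> v - u < d \<Longrightarrow>
        D v - D u \<le> \<eta> * (M v - M u)"
      using small[OF \<open>\<eta> > 0\<close>] by blast
    have "gauge (\<lambda>\<xi>::real. ball \<xi> (d / 2))" using d(1) by (intro gauge_ball) simp
    then obtain p where p: "p tagged_division_of {b..T}" "(\<lambda>\<xi>. ball \<xi> (d / 2)) fine p"
      using fine_division_exists_real by blast
    have "D (Sup K) - D (Inf K) \<le> \<eta> * (M (Sup K) - M (Inf K))" if "(\<xi>, K) \<in> p" for \<xi> K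
    proof -
      note c = tagged_division_of_real_cell[OF p(1) that]
      have "K \<subseteq> ball \<xi> (d / 2)" using p(2) that unfolding fine_def by blast
      then have "dist \<xi> (Inf K) < d / 2" "dist \<xi> (Sup K) < d / 2" using c(5,6) by auto
      then have "Sup K - Inf K < d" unfolding dist_real_def by linarith
      then show ?thesis using c(1-4) by (intro d(2)) auto
    qed
    then have "(\<Sum>(\<xi>, K)\<in>p. D (Sup K) - D (Inf K)) \<le> (\<Sum>(\<xi>, K)\<in>p. \<eta> * (M (Sup K) - M (Inf K)))"
      by (auto intro!: sum_mono)
    also have "\<dots> = \<eta> * (\<Sum>(\<xi>, K)\<in>p. M (Sup K) - M (Inf K))"
      by (simp add: split_def sum_distrib_left)
    finally show ?thesis by (simp only: additive_tagged_division_1[OF assms(1) p(1)])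
  qed
  have "((\<lambda>\<eta>. \<eta> * (M T - M b)) \<longlongrightarrow> 0 * (M T - M b)) (at_right 0)"
    by (intro tendsto_intros)
  then have "D T - D b \<le> 0 * (M T - M b)"
    by (rule tendsto_lowerbound) (auto simp: eventually_at_filter le)
  then show ?thesis by simp
qed

text \<open>Integrated form of \<open>x * e * s powr (e - 1) \<le> e * s powr e\<close> for
  \<open>s\<close> between \<open>x\<close> and \<open>y\<close>.\<close>

lemma powr_diff_le:
  fixes x y e :: real
  assumes "0 < x" "x \<le> y" "0 \<le> e"
  shows "x * (y powr e - x powr e) \<le> e / (1 + e) * (y powr (1 + e) - x powr (1 + e))"
proof -
  let ?\<psi> = "\<lambda>s. e / (1 + e) * s powr (1 + e) - x * s powr e"
  have "?\<psi> x \<le> ?\<psi> y"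
  proof (rule DERIV_nonneg_imp_nondecreasing[OF assms(2)])
    fix s assume s: "x \<le> s" "s \<le> y"
    then have "s > 0" using assms by simp
    have "(?\<psi> has_real_derivative e / (1 + e) * ((1 + e) * s powr e) - x * (e * s powr (e - 1))) (at s)"
      using \<open>s > 0\<close> by (auto intro!: derivative_eq_intros)
    moreover have "e / (1 + e) * ((1 + e) * s powr e) - x * (e * s powr (e - 1))
        = e * s powr (e - 1) * (s - x)"
    proof -
      have "s powr e = s powr (e - 1) * s" using \<open>s > 0\<close> by (simp add: powr_diff)
      moreover have "e / (1 + e) * ((1 + e) * s powr e) = e * s powr e" using assms by simp
      ultimately show ?thesis by (simp add: algebra_simps)
    qed
    moreover have "0 \<le> e * s powr (e - 1) * (s - x)" using s assms by simp
    ultimately show "\<exists>D. (?\<psi> has_real_derivative D) (at s) \<and> D \<ge> 0" by metis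
  qed
  then show ?thesis by (simp add: algebra_simps)
qed

section \<open>The inequality for powers of \<open>B\<close>\<close>

theorem lemma3p3:
  fixes B h H :: "real \<Rightarrow> real" and a b C \<epsilon> :: real
  assumes B_nonneg: "\<And>t. t \<ge> 0 \<Longrightarrow> B t \<ge> 0"
    and B_mono: "mono_on {0..} B"
    and B_diff: "B differentiable_on {0..}"
    and b: "b \<ge> 0" "B b = 1"
    and a: "a > 1"
    and C: "C > 0"
    and h_nonneg: "\<And>t. t \<ge> b \<Longrightarrow> h t \<ge> 0"
    and H_nonneg: "\<And>t. t \<ge> b \<Longrightarrow> H t \<ge> 0"
    and h_antimono: "antimono_on {b..} h"
    and H_antimono: "antimono_on {b..} H"
    and h_lim: "(h \<longlongrightarrow> 0) at_top"
    and H_lim: "(H \<longlongrightarrow> 0) at_top"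
    and ineq: "\<And>t. t \<ge> b \<Longrightarrow>
      - RS_integral_to_infinity B h t \<le> ereal (a * B t * h t + C * H t)"
    and eps: "0 \<le> \<epsilon>" "\<epsilon> < 1 / (a - 1)"
  shows "- RS_integral_to_infinity (\<lambda>t. B t powr (1 + \<epsilon>)) h b
    \<le> ereal (1 / (1 - \<epsilon> * (a - 1))) * (- RS_integral_to_infinity B h b)
      + ereal (C * \<epsilon> / (1 - \<epsilon> * (a - 1)))
          * (- RS_integral_to_infinity (\<lambda>t. B t powr (1 + \<epsilon>)) H b)"
proof -
  define q where "q = 1 + \<epsilon>"
  define k where "k = a * \<epsilon> / q"
  define c where "c = C * \<epsilon> / q"
  have q: "q \<ge> 1" using eps by (simp add: q_def)
  have eps_a: "\<epsilon> * (a - 1) < 1" using eps a by (simp add: field_simps)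
  \<comment> \<open>\<open>k < 1\<close> is equivalent to
    \<open>a * \<epsilon> < 1 + \<epsilon>\<close>, that is, to \<open>eps_a\<close>.\<close>
  then have k: "0 \<le> k" "k < 1"
    using a eps by (auto simp: k_def q_def field_simps)
  have c: "c \<ge> 0" using C eps by (simp add: c_def q_def)
  have B_mono': "B u \<le> B v" if "b \<le> u" "u \<le> v" for u v
    using mono_onD[OF B_mono, of u v] that b by auto
  have B1: "1 \<le> B t" if "b \<le> t" for t using B_mono'[of b t] that b by simp
  have B_cont: "continuous_on {b..} B"
    using differentiable_imp_continuous_on[OF B_diff] by (rule continuous_on_subset) (use b in auto)
  have powr_cont: "continuous_on {b..} (\<lambda>t. B t powr r)" for r
    using B1 by (intro continuous_intros B_cont) force
  have powr_mono: "B u powr r \<le> B v powr r" if "b \<le> u" "u \<le> v" "0 \<le> r" for u v r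
    using B1[of u] B_mono'[OF that(1,2)] that by (intro powr_mono2) auto
  have monoB: "mono_on {b..} B" using B_mono' by (auto intro: mono_onI)
  have monoBq: "mono_on {b..} (\<lambda>t. B t powr q)" using powr_mono q by (auto intro!: mono_onI)
  have h_le: "h v \<le> h u" if "b \<le> u" "u \<le> v" for u v
    using h_antimono that by (auto simp: monotone_on_def)
  have H_le: "H v \<le> H u" if "b \<le> u" "u \<le> v" for u v
    using H_antimono that by (auto simp: monotone_on_def)

  obtain \<Phi> where \<Phi>: "\<And>u v. b \<le> u \<Longrightarrow> u \<le> v \<Longrightarrow>
      B u * (h u - h v) \<le> \<Phi> v - \<Phi> u \<and> \<Phi> v - \<Phi> u \<le> B v * (h u - h v)"
    and \<Phi>_SUP: "\<And>u. b \<le> u \<Longrightarrow> - RS_integral_to_infinity B h u = (SUP T\<in>{u..}. ereal (\<Phi> T - \<Phi> u))"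
    using RS_integral_to_infinity_eq_SUP[OF B_cont monoB _ h_antimono] b by auto
  obtain \<Psi> where \<Psi>: "\<And>u v. b \<le> u \<Longrightarrow> u \<le> v \<Longrightarrow>
      B u powr q * (h u - h v) \<le> \<Psi> v - \<Psi> u \<and> \<Psi> v - \<Psi> u \<le> B v powr q * (h u - h v)"
    and \<Psi>_SUP: "\<And>u. b \<le> u \<Longrightarrow> - RS_integral_to_infinity (\<lambda>t. B t powr q) h u
      = (SUP T\<in>{u..}. ereal (\<Psi> T - \<Psi> u))"
    using RS_integral_to_infinity_eq_SUP[OF powr_cont monoBq _ h_antimono] by auto
  obtain \<Upsilon> where \<Upsilon>: "\<And>u v. b \<le> u \<Longrightarrow> u \<le> v \<Longrightarrow>
      B u powr q * (H u - H v) \<le> \<Upsilon> v - \<Upsilon> u \<and> \<Upsilon> v - \<Upsilon> u \<le> B v powr q * (H u - H v)"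
    and \<Upsilon>_SUP: "\<And>u. b \<le> u \<Longrightarrow> - RS_integral_to_infinity (\<lambda>t. B t powr q) H u
      = (SUP T\<in>{u..}. ereal (\<Upsilon> T - \<Upsilon> u))"
    using RS_integral_to_infinity_eq_SUP[OF powr_cont monoBq _ H_antimono] by auto

  define F where "F = - RS_integral_to_infinity B h b"
  define Y where "Y = - RS_integral_to_infinity (\<lambda>t. B t powr q) H b"
  define s where "s = 1 - \<epsilon> * (a - 1)"
  have s: "s > 0" using eps_a by (simp add: s_def)

  have "ereal (\<Psi> T - \<Psi> b) \<le> ereal (1 / s) * F + ereal (C * \<epsilon> / s) * Y" if T: "b \<le> T" for T
  proof -
    \<comment> \<open>The tail integral of \<open>B\<close> for \<open>h\<close> cut off to 0 after
      \<open>T\<close>; the term \<open>B T * h T\<close> is the jump created by the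
      cut-off.\<close>
    define R where "R t = \<Phi> T - \<Phi> t + B T * h T" for t
    have R_SUP: "ereal (R t) \<le> - RS_integral_to_infinity B h t" if "b \<le> t" "t \<le> T" for t
      unfolding R_def \<Phi>_SUP[OF that(1)] using that T \<Phi> h_lim
      by (intro ereal_le_SUP_tail) auto
    have R_le: "R t \<le> a * B t * h t + C * H t" if "b \<le> t" "t \<le> T" for t
      using order.trans[OF R_SUP[OF that] ineq[OF that(1)]] by simp
    \<comment> \<open>Formally
      \<open>dD = R d(B powr \<epsilon>) - (k * h + c * H) d(B powr q)\<close>: all terms in
      \<open>dh\<close> and \<open>dH\<close> cancel, and the hypothesis makes the rest
      nonpositive.\<close>
    define D where "D t = (1 - k) * \<Psi> t + B t powr \<epsilon> * R t - k * (h t * B t powr q)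
      - c * (H t * B t powr q + \<Upsilon> t)" for t
    \<comment> \<open>A non-decreasing function whose increments, times \<eta>, dominate the two
      second-order errors collected in \<open>err\<close>.\<close>
    define M where "M t = a * h b * B t powr \<epsilon> - (1 - k) * h t" for t
    have "D T \<le> D b"
    proof (rule nonincreasing_endpoints_if_small_increments[OF T, of D M])
      fix \<eta> :: real assume \<eta>: "\<eta> > 0"
      have "uniformly_continuous_on {b..T} B" "uniformly_continuous_on {b..T} (\<lambda>t. B t powr q)"
        by (intro compact_uniformly_continuous compact_Icc
          continuous_on_subset[OF B_cont] continuous_on_subset[OF powr_cont]; force)+
      note uc = this[unfolded uniformly_continuous_on_def, rule_format, OF \<eta>]
      obtain d1 where d1: "d1 > 0"
        "\<And>x y. x \<in> {b..T} \<Longrightarrow> y \<in> {b..T} \<Longrightarrow> dist y x < d1 \<Longrightarrow> dist (B y) (B x) < \<eta>"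
        using uc(1) by blast
      obtain d2 where d2: "d2 > 0" "\<And>x y. x \<in> {b..T} \<Longrightarrow> y \<in> {b..T} \<Longrightarrow> dist y x < d2 \<Longrightarrow>
          dist (B y powr q) (B x powr q) < \<eta>"
        using uc(2) by blast
      show "\<exists>d>0. \<forall>u v. b \<le> u \<and> u \<le> v \<and> v \<le> T \<and> v - u < d \<longrightarrow> D v - D u \<le> \<eta> * (M v - M u)"
      proof (intro exI[of _ "min d1 d2"] conjI allI impI)
        fix u v assume "b \<le> u \<and> u \<le> v \<and> v \<le> T \<and> v - u < min d1 d2"
        then have uv: "b \<le> u" "u \<le> v" "v \<le> T" "v - u < d1" "v - u < d2" by auto
        define x y where "x = B u" "y = B v"
        define xe ye xq yq where "xe = x powr \<epsilon>" "ye = y powr \<epsilon>" "xq = x powr q" "yq = y powr q"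
        note xy = x_y_def xe_ye_xq_yq_def
        have x1: "1 \<le> x" and xy_le: "x \<le> y" using B1 B_mono' uv by (auto simp: xy)
        have pe: "xe \<le> ye" and pq: "xq \<le> yq" using powr_mono uv eps q by (auto simp: xy)
        have near: "y - x \<le> \<eta>" "yq - xq \<le> \<eta>"
          using d1(2)[of u v] d2(2)[of u v] uv by (auto simp: xy dist_real_def)
        have xq_eq: "xq = xe * x" using x1 by (simp add: xy q_def powr_add)
        have xe0: "0 \<le> xe" by (simp add: xy)
        have pw: "x * (ye - xe) \<le> \<epsilon> / q * (yq - xq)"
          using powr_diff_le[of x y \<epsilon>] x1 xy_le eps by (simp add: xy q_def)
        \<comment> \<open>The term in \<open>H\<close> carries no factor \<open>B\<close>; the bound
          \<open>1 \<le> x\<close> supplies it.\<close>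
        have pw1: "ye - xe \<le> \<epsilon> / q * (yq - xq)"
          using mult_right_mono[OF x1, of "ye - xe"] pe pw by simp
        have \<Psi>_inc: "(1 - k) * (\<Psi> v - \<Psi> u) \<le> (1 - k) * (yq * (h u - h v))"
          using \<Psi>[of u v] uv k by (intro mult_left_mono) (auto simp: xy)
        \<comment> \<open>The product increment is split as
          \<open>xe * (R v - R u) + (ye - xe) * R v\<close>, so the hypothesis is used at
          \<open>v\<close>.\<close>
        have "xe * (R v - R u) \<le> xe * (- (x * (h u - h v)))"
          using \<Phi>[of u v] uv xe0 by (intro mult_left_mono) (auto simp: xy R_def)
        moreover have "(ye - xe) * R v \<le> (ye - xe) * (a * y * h v + C * H v)"
          using R_le[of v] uv pe by (intro mult_left_mono) (auto simp: xy)
        ultimately have R_inc: "ye * R v - xe * R u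
            \<le> - (xq * (h u - h v)) + (ye - xe) * (a * y * h v + C * H v)"
          unfolding xq_eq by (simp add: algebra_simps)
        have "c * (xq * (H u - H v)) \<le> c * (\<Upsilon> v - \<Upsilon> u)"
          using \<Upsilon>[of u v] uv c by (intro mult_left_mono) (auto simp: xy)
        moreover have "C * H v * (ye - xe) \<le> C * H v * (\<epsilon> / q * (yq - xq))"
          using pw1 C H_nonneg[of v] uv by (intro mult_left_mono) auto
        ultimately have H_inc: "C * H v * (ye - xe) - c * (H v * yq - H u * xq + (\<Upsilon> v - \<Upsilon> u)) \<le> 0"
          by (simp add: c_def algebra_simps diff_divide_distrib add_divide_distrib)
        \<comment> \<open>The hypothesis at \<open>v\<close> brings the factor \<open>y\<close>,
          while \<open>pw\<close> controls only \<open>x\<close>; the difference is a product of two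
          small increments and goes into the error.\<close>
        have "a * h v * (x * (ye - xe)) \<le> a * h v * (\<epsilon> / q * (yq - xq))"
          using pw a h_nonneg[of v] uv by (intro mult_left_mono) auto
        then have h_inc: "a * h v * ((ye - xe) * y) - k * h v * (yq - xq)
            \<le> a * h v * ((ye - xe) * (y - x))"
          by (simp add: k_def algebra_simps diff_divide_distrib add_divide_distrib)
        have "a * h v * ((ye - xe) * (y - x)) \<le> a * h b * ((ye - xe) * \<eta>)"
          using near h_le[of b v] h_nonneg[of b] a uv pe xy_le h_nonneg[of v]
          by (intro mult_mono) auto
        moreover have "(1 - k) * (h u - h v) * (yq - xq) \<le> (1 - k) * (h u - h v) * \<eta>"
          using near k h_le[of u v] uv by (intro mult_left_mono) auto
        ultimately have err: "a * h v * ((ye - xe) * (y - x)) + (1 - k) * (h u - h v) * (yq - xq)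
            \<le> \<eta> * (M v - M u)"
          unfolding M_def by (simp add: xy algebra_simps)
        have "D v - D u = (1 - k) * (\<Psi> v - \<Psi> u) + (ye * R v - xe * R u)
            - k * (h v * yq - h u * xq) - c * (H v * yq - H u * xq + (\<Upsilon> v - \<Upsilon> u))"
          unfolding D_def by (simp add: xy algebra_simps)
        also have "\<dots> \<le> (1 - k) * (yq * (h u - h v))
            + (- (xq * (h u - h v)) + (ye - xe) * (a * y * h v + C * H v))
            - k * (h v * yq - h u * xq) - c * (H v * yq - H u * xq + (\<Upsilon> v - \<Upsilon> u))"
          using \<Psi>_inc R_inc by linarith
        also have "\<dots> = (1 - k) * (h u - h v) * (yq - xq)
            + (a * h v * ((ye - xe) * y) - k * h v * (yq - xq))
            + (C * H v * (ye - xe) - c * (H v * yq - H u * xq + (\<Upsilon> v - \<Upsilon> u)))"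
          by (simp add: algebra_simps)
        also have "\<dots> \<le> \<eta> * (M v - M u)" using h_inc H_inc err by linarith
        finally show "D v - D u \<le> \<eta> * (M v - M u)" .
      qed (use d1 d2 in auto)
    qed
    moreover have "B T powr \<epsilon> * R T = B T powr q * h T"
      using B1[OF T] by (simp add: R_def q_def powr_add)
    moreover have "k * (h T * B T powr q) \<le> h T * B T powr q"
      using k h_nonneg[OF T] by (intro mult_left_le_one_le) auto
    ultimately have main: "(1 - k) * (\<Psi> T - \<Psi> b)
        \<le> R b - k * h b + c * (\<Upsilon> T - \<Upsilon> b + B T powr q * H T - H b)"
      unfolding D_def using b by (simp add: algebra_simps)
    define Z where "Z = \<Upsilon> T - \<Upsilon> b + B T powr q * H T"
    have qk: "q * k = a * \<epsilon>" "q * c = C * \<epsilon>" using q by (auto simp: k_def c_def)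
    \<comment> \<open>After multiplication by \<open>q\<close>, the coefficient of
      \<open>R b\<close> is \<open>1 + \<epsilon>\<close>. Using the hypothesis again at
      \<open>b\<close>, where \<open>B b = 1\<close>, the excess \<open>\<epsilon> * R b\<close> is
      absorbed by the terms in \<open>h b\<close> and \<open>H b\<close>; on the left,
      \<open>q * (1 - k) = s\<close>.\<close>
    have "\<epsilon> * R b \<le> \<epsilon> * (a * h b + C * H b)"
      using R_le[of b] T b eps by (intro mult_left_mono) auto
    moreover have "q * ((1 - k) * (\<Psi> T - \<Psi> b)) \<le> q * (R b - k * h b + c * (Z - H b))"
      using main q by (intro mult_left_mono) (auto simp: Z_def)
    moreover have "q * ((1 - k) * (\<Psi> T - \<Psi> b)) = (q - q * k) * (\<Psi> T - \<Psi> b)"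
      by (simp add: algebra_simps)
    moreover have "q - a * \<epsilon> = s" by (simp add: s_def q_def algebra_simps)
    moreover have "q * (R b - k * h b + c * (Z - H b))
        = R b + \<epsilon> * R b - q * k * h b + (q * c * Z - q * c * H b)"
      by (simp add: q_def algebra_simps)
    moreover have "\<epsilon> * (a * h b + C * H b) = a * \<epsilon> * h b + C * \<epsilon> * H b"
      by (simp add: algebra_simps)
    ultimately have "s * (\<Psi> T - \<Psi> b) \<le> R b + C * \<epsilon> * Z"
      unfolding qk by simp
    then have "\<Psi> T - \<Psi> b \<le> 1 / s * R b + C * \<epsilon> / s * Z"
      using s by (simp add: field_simps)
    then have "ereal (\<Psi> T - \<Psi> b) \<le> ereal (1 / s) * ereal (R b) + ereal (C * \<epsilon> / s) * ereal Z"
      by simp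
    also have "\<dots> \<le> ereal (1 / s) * F + ereal (C * \<epsilon> / s) * Y"
    proof (intro add_mono ereal_mult_left_mono)
      show "ereal (R b) \<le> F" unfolding F_def using R_SUP T by simp
      show "ereal Z \<le> Y" unfolding Y_def Z_def \<Upsilon>_SUP[OF order.refl]
        using T \<Upsilon> H_lim by (intro ereal_le_SUP_tail[where f = "\<lambda>t. B t powr q"]) auto
    qed (use s C eps in auto)
    finally show ?thesis .
  qed
  \<comment> \<open>The bound does not depend on \<open>T\<close>, so it passes to the
    supremum.\<close>
  then have "- RS_integral_to_infinity (\<lambda>t. B t powr q) h b
      \<le> ereal (1 / s) * F + ereal (C * \<epsilon> / s) * Y"
    unfolding \<Psi>_SUP[OF order.refl] by (intro SUP_least) auto
  then show ?thesis unfolding F_def Y_def s_def q_def .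
qed

end
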